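(* Consider a solution $(p,q,r,\gamma_1,\gamma_2,\gamma_3)(t)$ of the Kovalevskaya system $$2\dot p - qr = 0,\quad 2\dot q + rp = \gamma_3,\quad \dot r = -\gamma_2,\quad \dot\gamma_1 = r\gamma_2 - q\gamma_3,\quad \dot\gamma_2 = p\gamma_3 - r\gamma_1,\quad \dot\gamma_3 = q\gamma_1 - p\gamma_2,$$ with $\gamma_1^2+\gamma_2^2+\gamma_3^2=1$ and zero area integral $2(p\gamma_1+q\gamma_2)+r\gamma_3=0$. Let $h = p^2+q^2+\tfrac12 r^2+\gamma_1$ and $k^2=(p^2-q^2-\gamma_1)^2+(2pq-\gamma_2)^2$ be the values of the other two first integrals on this solution. Suppose that $(k^2,h)$ belongs to the open region $O_1=\{(k^2,h): h^2<k^2<1\}$ and that the two-dimensional invariant torus containing the solution is non-resonant. Then the mean motion of the line of nodes is zero: the precession angle $\psi$ along the solution has mean motion $\Lambda=0$.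
   Context: Here $(p,q,r,\gamma_1,\gamma_2,\gamma_3)\in\mathbb{R}^6$. The four first integrals are $p^2+q^2+\tfrac12r^2+\gamma_1=h$, $2(p\gamma_1+q\gamma_2)+r\gamma_3=c$ (the area integral), $\gamma_1^2+\gamma_2^2+\gamma_3^2=1$, and $(p^2-q^2-\gamma_1)^2+(2pq-\gamma_2)^2=k^2$. For $c=0$ and $(k^2,h)\in O_1$ these integrals are functionally independent on their common level set, and this level set is a single two-dimensional torus, invariant under the flow. On it there are angle coordinates $\varphi_1,\varphi_2$ (mod $2\pi$) in which the flow is $\dot\varphi_i=\omega_i$ with constants $\omega_1,\omega_2$; the torus is called non-resonant if $\omega_1,\omega_2$ are linearly independent over $\mathbb{Q}$. Precession angle (angle of the line of nodes): the real-valued function $\psi(t)$ along the solution defined, up to its initial value, by $$\dot\psi=\frac{p\gamma_1+q\gamma_2}{\gamma_1^2+\gamma_2^2}.$$ For $c=0$ and $(k^2,h)\in O_1$ solutions never pass through points with $\gamma_3=\pm1$, so the right-hand side is well defined. Mean motion: a function $\psi(t)$ has mean motion $\Lambda\in\mathbb{R}$ if $\psi(t)=\psi(0)+\Lambda t+O(1)$ for all $t$, i.e. $\psi(t)-\Lambda t$ is bounded. *)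

theory Defs
  imports "HOL-Analysis.Analysis"
begin

text \<open>Phase points are tuples \<open>(p, q, r, \<gamma>\<^sub>1, \<gamma>\<^sub>2, \<gamma>\<^sub>3)\<close>.\<close>

type_synonym phase = "real \<times> real \<times> real \<times> real \<times> real \<times> real"

text \<open>The right-hand side of the system
  \<open>2p' - qr = 0\<close>, \<open>2q' + rp = \<gamma>\<^sub>3\<close>, \<open>r' = -\<gamma>\<^sub>2\<close>,
  \<open>\<gamma>\<^sub>1' = r\<gamma>\<^sub>2 - q\<gamma>\<^sub>3\<close>, \<open>\<gamma>\<^sub>2' = p\<gamma>\<^sub>3 - r\<gamma>\<^sub>1\<close>, \<open>\<gamma>\<^sub>3' = q\<gamma>\<^sub>1 - p\<gamma>\<^sub>2\<close>,
  solved for the derivatives.\<close>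

fun kovalevskaya_field :: "phase \<Rightarrow> phase" where
  "kovalevskaya_field (p, q, r, \<gamma>1, \<gamma>2, \<gamma>3) =
     (q * r / 2, (\<gamma>3 - r * p) / 2, - \<gamma>2,
      r * \<gamma>2 - q * \<gamma>3, p * \<gamma>3 - r * \<gamma>1, q * \<gamma>1 - p * \<gamma>2)"

definition kovalevskaya_solution :: "(real \<Rightarrow> phase) \<Rightarrow> bool" where
  "kovalevskaya_solution x \<longleftrightarrow>
     (\<forall>t. (x has_vector_derivative kovalevskaya_field (x t)) (at t))"

fun energy_integral :: "phase \<Rightarrow> real" where
  "energy_integral (p, q, r, \<gamma>1, \<gamma>2, \<gamma>3) = p\<^sup>2 + q\<^sup>2 + r\<^sup>2 / 2 + \<gamma>1"

fun area_integral :: "phase \<Rightarrow> real" where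
  "area_integral (p, q, r, \<gamma>1, \<gamma>2, \<gamma>3) = 2 * (p * \<gamma>1 + q * \<gamma>2) + r * \<gamma>3"

fun geometric_integral :: "phase \<Rightarrow> real" where
  "geometric_integral (p, q, r, \<gamma>1, \<gamma>2, \<gamma>3) = \<gamma>1\<^sup>2 + \<gamma>2\<^sup>2 + \<gamma>3\<^sup>2"

fun kovalevskaya_integral :: "phase \<Rightarrow> real" where
  "kovalevskaya_integral (p, q, r, \<gamma>1, \<gamma>2, \<gamma>3) =
     (p\<^sup>2 - q\<^sup>2 - \<gamma>1)\<^sup>2 + (2 * p * q - \<gamma>2)\<^sup>2"

text \<open>The parameter \<open>K\<close> is the value \<open>k\<^sup>2\<close> of the Kovalevskaya integral.\<close>

definition zero_area_level :: "real \<Rightarrow> real \<Rightarrow> phase set" where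
  "zero_area_level K h =
     {z. geometric_integral z = 1 \<and> area_integral z = 0 \<and>
         energy_integral z = h \<and> kovalevskaya_integral z = K}"

definition region_O1 :: "(real \<times> real) set" where
  "region_O1 = {(K, h). h\<^sup>2 < K \<and> K < 1}"

text \<open>Angle coordinates (mod \<open>2\<pi>\<close>) on \<open>T\<close> are given by their inverse \<open>\<Phi>\<close>: a \<open>C\<^sup>1\<close> immersion of the
  plane that identifies two points exactly when they differ by \<open>2\<pi>\<close> times an integer vector, hence
  descends to a diffeomorphism of the standard two-torus onto \<open>T\<close>. The last conjunct says that
  straight lines \<open>\<phi>\<^sub>i = \<phi>\<^sub>i(0) + \<omega>\<^sub>i t\<close> in the angles are solutions of the system.\<close>

definition linearizing_angles ::
    "phase set \<Rightarrow> (real \<times> real \<Rightarrow> phase) \<Rightarrow> real \<Rightarrow> real \<Rightarrow> bool" where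
  "linearizing_angles T \<Phi> \<omega>1 \<omega>2 \<longleftrightarrow>
     range \<Phi> = T \<and>
     (\<forall>a1 a2 b1 b2. \<Phi> (a1, a2) = \<Phi> (b1, b2) \<longleftrightarrow>
        (\<exists>m n :: int. a1 - b1 = 2 * pi * of_int m \<and> a2 - b2 = 2 * pi * of_int n)) \<and>
     (\<exists>D :: real \<times> real \<Rightarrow> (real \<times> real) \<Rightarrow>\<^sub>L phase.
        continuous_on UNIV D \<and>
        (\<forall>a. (\<Phi> has_derivative blinfun_apply (D a)) (at a) \<and> inj (blinfun_apply (D a)))) \<and>
     (\<forall>a1 a2. kovalevskaya_solution (\<lambda>t. \<Phi> (a1 + \<omega>1 * t, a2 + \<omega>2 * t)))"

definition rationally_independent :: "real \<Rightarrow> real \<Rightarrow> bool" where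
  "rationally_independent \<omega>1 \<omega>2 \<longleftrightarrow>
     (\<forall>a\<in>\<rat>. \<forall>b\<in>\<rat>. a * \<omega>1 + b * \<omega>2 = 0 \<longrightarrow> a = 0 \<and> b = 0)"

definition non_resonant_torus :: "phase set \<Rightarrow> bool" where
  "non_resonant_torus T \<longleftrightarrow>
     (\<exists>\<Phi> \<omega>1 \<omega>2. linearizing_angles T \<Phi> \<omega>1 \<omega>2 \<and> rationally_independent \<omega>1 \<omega>2)"

text \<open>The denominator vanishes only at \<open>\<gamma>\<^sub>3 = \<plusminus>1\<close>. With zero area integral this forces \<open>r = 0\<close> and
  then \<open>K = h\<^sup>2\<close>, so it does not occur on the levels with \<open>(K, h)\<close> in \<^const>\<open>region_O1\<close>.\<close>

fun precession_rate :: "phase \<Rightarrow> real" where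
  "precession_rate (p, q, r, \<gamma>1, \<gamma>2, \<gamma>3) = (p * \<gamma>1 + q * \<gamma>2) / (\<gamma>1\<^sup>2 + \<gamma>2\<^sup>2)"

definition precession_angle :: "(real \<Rightarrow> phase) \<Rightarrow> (real \<Rightarrow> real) \<Rightarrow> bool" where
  "precession_angle x \<psi> \<longleftrightarrow>
     (\<forall>t. (\<psi> has_real_derivative precession_rate (x t)) (at t))"

definition has_mean_motion :: "(real \<Rightarrow> real) \<Rightarrow> real \<Rightarrow> bool" where
  "has_mean_motion \<psi> \<Lambda> \<longleftrightarrow> bounded (range (\<lambda>t. \<psi> t - \<Lambda> * t))"

end

theory Submission
  imports Defs
begin

text \<open>The Hamiltonian field of the Kovalevskaya integral commutes with the given field, and in the
  angle coordinates it is a constant field \<open>\<eta>\<close>, independent of the frequency vector \<open>w\<close>. Let \<open>F\<close> and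
  \<open>G\<close> be the rates of the precession angle along the two fields, as functions of the angles. The
  identity \<open>\<partial>\<^sub>\<eta> F = \<partial>\<^sub>w G\<close> shows that the \<open>\<eta>\<close>-derivative of the increment
  \<open>I(a, t) = \<integral>\<^sub>0\<^sup>t F(a + s w) ds\<close> is \<open>G(a + t w) - G(a)\<close>, and its \<open>w\<close>-derivative is \<open>F(a + t w) - F(a)\<close>.
  Thus \<open>I\<close> is Lipschitz in \<open>a\<close> uniformly in \<open>t\<close>. The reflection
  \<open>(p, q, r, \<gamma>\<^sub>1, \<gamma>\<^sub>2, \<gamma>\<^sub>3) \<mapsto> (-p, -q, r, \<gamma>\<^sub>1, \<gamma>\<^sub>2, -\<gamma>\<^sub>3)\<close> preserves the system and the torus and
  changes the sign of the precession rate, so the reflected solution starts at some \<open>b\<close> with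
  \<open>I(b, t) = - I(a, t)\<close>. Hence \<open>2 |I(a, t)| = |I(a, t) - I(b, t)|\<close> is bounded in \<open>t\<close>.\<close>

subsection \<open>Analytic preliminaries\<close>

text \<open>Gronwall's argument: by Cauchy-Schwarz the weighted square \<open>w\<close> is
  nonincreasing; it is nonnegative and starts at zero.\<close>

lemma zero_if_linear_growth_forward:
  fixes e :: "real \<Rightarrow> 'a::real_inner"
  assumes e: "\<And>t. (e has_vector_derivative e' t) (at t)"
    and le: "\<And>t. norm (e' t) \<le> L * norm (e t)"
    and "e 0 = 0" "0 \<le> t"
  shows "e t = 0"
proof -
  define w where "w t = exp (- 2 * L * t) * (e t \<bullet> e t)" for t
  have "(w has_real_derivative exp (- 2 * L * s) * (2 * (e s \<bullet> e' s) - 2 * L * (e s \<bullet> e s))) (at s)" for s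
  proof -
    have "((\<lambda>t. e t \<bullet> e t) has_real_derivative e s \<bullet> e' s + e' s \<bullet> e s) (at s)"
      unfolding has_field_derivative_def
      by (rule has_derivative_eq_rhs[OF has_derivative_inner[OF e[of s, unfolded has_vector_derivative_def]
            e[of s, unfolded has_vector_derivative_def]]]) (simp add: fun_eq_iff algebra_simps)
    then show ?thesis
      unfolding w_def
      by (auto intro!: derivative_eq_intros simp: algebra_simps inner_commute)
  qed
  moreover have "exp (- 2 * L * s) * (2 * (e s \<bullet> e' s) - 2 * L * (e s \<bullet> e s)) \<le> 0" for s
  proof -
    have "e s \<bullet> e' s \<le> norm (e s) * norm (e' s)"
      by (rule norm_cauchy_schwarz)
    also have "\<dots> \<le> norm (e s) * (L * norm (e s))"
      by (intro mult_left_mono le) auto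
    also have "\<dots> = L * (e s \<bullet> e s)"
      by (simp add: power2_norm_eq_inner[symmetric] power2_eq_square)
    finally show ?thesis
      by (simp add: mult_le_0_iff)
  qed
  ultimately have "w t \<le> w 0"
    using \<open>0 \<le> t\<close> by (intro DERIV_nonpos_imp_nonincreasing[of 0 t w]) blast+
  then have "e t \<bullet> e t \<le> 0"
    by (simp add: w_def \<open>e 0 = 0\<close> mult_le_0_iff)
  then show ?thesis
    by (metis inner_eq_zero_iff inner_ge_zero order_antisym)
qed

text \<open>Serves twice: for uniqueness of solutions that stay on a level, and to carry the
  tangency of the second field along an orbit. Negative times follow by time reversal.\<close>

lemma zero_if_linear_growth:
  fixes e :: "real \<Rightarrow> 'a::real_inner"
  assumes e: "\<And>t. (e has_vector_derivative e' t) (at t)"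
    and le: "\<And>t. norm (e' t) \<le> L * norm (e t)"
    and "e 0 = 0"
  shows "e t = 0"
proof (cases "0 \<le> t")
  case True
  then show ?thesis
    using zero_if_linear_growth_forward assms by blast
next
  case False
  have "((\<lambda>t. e (- t)) has_vector_derivative - e' (- t)) (at t)" for t
    using vector_diff_chain_at[OF has_vector_derivative_minus[OF has_vector_derivative_id], of e "e' (- t)" t] e[of "- t"]
    by (simp add: o_def)
  from zero_if_linear_growth_forward[OF this, of L "- t"] show ?thesis
    using le \<open>e 0 = 0\<close> False by simp
qed

text \<open>As \<Phi> is only C^1, the mixed second derivative cannot simply be interchanged. The
  integrated equation of motion is differentiated in the direction \<open>v\<close> under the
  integral sign, and the resulting integral equation for \<open>D\<close> is then differentiated in
  time.\<close>

lemma variational_equation: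
  fixes \<Phi> :: "'a::real_normed_vector \<Rightarrow> 'b::euclidean_space"
    and D :: "'a \<Rightarrow> 'a \<Rightarrow>\<^sub>L 'b"
  assumes \<Phi>: "\<And>a. (\<Phi> has_derivative blinfun_apply (D a)) (at a)"
    and D: "continuous_on UNIV D"
    and F: "\<And>z. (F has_derivative F' z) (at z)"
    and F': "continuous_on UNIV (\<lambda>(z, v). F' z v)"
    and curve: "\<And>a t. ((\<lambda>t. \<Phi> (a + t *\<^sub>R w)) has_vector_derivative F (\<Phi> (a + t *\<^sub>R w))) (at t)"
  shows "((\<lambda>t. D (a + t *\<^sub>R w) v) has_vector_derivative
           F' (\<Phi> (a + t *\<^sub>R w)) (D (a + t *\<^sub>R w) v)) (at t)"
proof -
  \<comment> \<open>The base point lies one time unit before the point of interest, so that the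
    latter has parameter 1, interior to \<open>{0..2}\<close>, and integrals starting at 0 give a
    two-sided derivative.\<close>
  define b where "b = a + (t - 1) *\<^sub>R w"
  define f where "f \<epsilon> s = F' (\<Phi> (b + \<epsilon> *\<^sub>R v + s *\<^sub>R w)) (D (b + \<epsilon> *\<^sub>R v + s *\<^sub>R w) v)" for \<epsilon> s
  have cont_\<Phi>: "continuous_on UNIV \<Phi>"
    by (intro continuous_at_imp_continuous_on ballI has_derivative_continuous[OF \<Phi>])
  have cont_F: "continuous_on UNIV F"
    by (intro continuous_at_imp_continuous_on ballI has_derivative_continuous[OF F])
  have cont_f: "continuous_on S (\<lambda>(\<epsilon>, s). f \<epsilon> s)" for S
  proof -
    have "continuous_on S (\<lambda>x. \<Phi> (b + fst x *\<^sub>R v + snd x *\<^sub>R w))"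
      by (rule continuous_on_compose2[OF cont_\<Phi>]) (simp_all add: continuous_intros)
    moreover have "continuous_on S (\<lambda>x. D (b + fst x *\<^sub>R v + snd x *\<^sub>R w))"
      by (rule continuous_on_compose2[OF D]) (simp_all add: continuous_intros)
    then have "continuous_on S (\<lambda>x. D (b + fst x *\<^sub>R v + snd x *\<^sub>R w) v)"
      by (rule blinfun.continuous_on) simp
    ultimately have "continuous_on S (\<lambda>x. (\<Phi> (b + fst x *\<^sub>R v + snd x *\<^sub>R w), D (b + fst x *\<^sub>R v + snd x *\<^sub>R w) v))"
      by (rule continuous_on_Pair)
    from continuous_on_compose2[OF F' this]
    have "continuous_on S (\<lambda>x. F' (\<Phi> (b + fst x *\<^sub>R v + snd x *\<^sub>R w)) (D (b + fst x *\<^sub>R v + snd x *\<^sub>R w) v))"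
      by simp
    then show ?thesis
      by (simp add: f_def case_prod_unfold)
  qed
  have cont_f0: "continuous_on S (f 0)" for S
  proof -
    have "continuous_on S (Pair (0::real))"
      by (rule continuous_on_Pair continuous_on_const continuous_on_id)+
    from continuous_on_compose2[OF cont_f[of UNIV] this] show ?thesis
      by simp
  qed
  have \<Phi>_shift: "((\<lambda>\<epsilon>. \<Phi> (b + \<epsilon> *\<^sub>R v + s *\<^sub>R w)) has_vector_derivative
      D (b + \<epsilon> *\<^sub>R v + s *\<^sub>R w) v) (at \<epsilon>)" for \<epsilon> s
    unfolding has_vector_derivative_def
    by (rule has_derivative_eq_rhs[OF has_derivative_compose[OF _ \<Phi>]])
      (auto intro!: derivative_eq_intros simp: blinfun.scaleR_right)
  have F'_scaleR: "F' z (c *\<^sub>R y) = c *\<^sub>R F' z y" for z c y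
    by (rule linear_cmul[OF has_derivative_linear[OF F]])
  \<comment> \<open>The displacement over time \<open>u\<close> is differentiated in \<epsilon> at 0
    in two ways: under the integral, and through its end points by the fundamental theorem.\<close>
  have integral_eq: "D (b + u *\<^sub>R w) v = D b v + integral {0..u} (f 0)" if "0 \<le> u" for u
  proof -
    have "((\<lambda>\<epsilon>. integral (cbox 0 u) (\<lambda>s. F (\<Phi> (b + \<epsilon> *\<^sub>R v + s *\<^sub>R w))))
            has_vector_derivative integral (cbox 0 u) (f 0)) (at 0 within UNIV)"
    proof (rule leibniz_rule_vector_derivative)
      fix \<epsilon> s :: real
      show "((\<lambda>\<epsilon>. F (\<Phi> (b + \<epsilon> *\<^sub>R v + s *\<^sub>R w))) has_vector_derivative f \<epsilon> s) (at \<epsilon> within UNIV)"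
        using has_derivative_compose[OF \<Phi>_shift[of s \<epsilon>, unfolded has_vector_derivative_def] F]
        by (simp add: has_vector_derivative_def f_def F'_scaleR)
      show "(\<lambda>s. F (\<Phi> (b + \<epsilon> *\<^sub>R v + s *\<^sub>R w))) integrable_on cbox 0 u"
        by (rule integrable_continuous, rule continuous_on_compose2[OF cont_F],
            rule continuous_on_compose2[OF cont_\<Phi>]) (simp_all add: continuous_intros)
    qed (use cont_f in simp_all)
    moreover have "integral (cbox 0 u) (\<lambda>s. F (\<Phi> (b + \<epsilon> *\<^sub>R v + s *\<^sub>R w))) =
        \<Phi> (b + \<epsilon> *\<^sub>R v + u *\<^sub>R w) - \<Phi> (b + \<epsilon> *\<^sub>R v + 0 *\<^sub>R w)" for \<epsilon>
    proof -
      have "((\<lambda>s. F (\<Phi> (b + \<epsilon> *\<^sub>R v + s *\<^sub>R w))) has_integral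
          \<Phi> (b + \<epsilon> *\<^sub>R v + u *\<^sub>R w) - \<Phi> (b + \<epsilon> *\<^sub>R v + 0 *\<^sub>R w)) {0..u}"
        by (rule fundamental_theorem_of_calculus[OF that]) (rule has_vector_derivative_at_within[OF curve])
      then show ?thesis
        by (simp add: integral_unique)
    qed
    moreover have "((\<lambda>\<epsilon>. \<Phi> (b + \<epsilon> *\<^sub>R v + u *\<^sub>R w) - \<Phi> (b + \<epsilon> *\<^sub>R v + 0 *\<^sub>R w))
        has_vector_derivative D (b + u *\<^sub>R w) v - D b v) (at 0)"
      using has_vector_derivative_diff[OF \<Phi>_shift[of u 0] \<Phi>_shift[of 0 0]] by simp
    ultimately have "integral (cbox 0 u) (f 0) = D (b + u *\<^sub>R w) v - D b v"
      by (simp only: vector_derivative_unique_at)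
    then show ?thesis
      by simp
  qed
  have "((\<lambda>u. integral {0..u} (f 0)) has_vector_derivative f 0 1) (at 1 within {0..2})"
    by (rule integral_has_vector_derivative[OF cont_f0]) simp
  then have "((\<lambda>u. integral {0..u} (f 0)) has_vector_derivative f 0 1) (at 1)"
    by (simp only: at_within_Icc_at[of 0 "1::real" 2, simplified])
  from has_vector_derivative_add[OF has_vector_derivative_const this]
  have "((\<lambda>u. D b v + integral {0..u} (f 0)) has_vector_derivative f 0 1) (at 1)"
    by (simp only: add_0)
  then have "((\<lambda>u. D (b + u *\<^sub>R w) v) has_vector_derivative f 0 1) (at 1)"
    by (rule has_vector_derivative_transform_within_open[of _ _ _ "{0<..}"])
      (simp_all only: integral_eq[symmetric] greaterThan_iff less_imp_le open_greaterThan zero_less_one)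
  moreover have "((\<lambda>s. s - t + 1) has_vector_derivative 1) (at t)"
    by (auto intro!: derivative_eq_intros)
  ultimately have "((\<lambda>u. D (b + u *\<^sub>R w) v) \<circ> (\<lambda>s. s - t + 1) has_vector_derivative 1 *\<^sub>R f 0 1) (at t)"
    by (intro vector_diff_chain_at) simp_all
  moreover have "b + (s - t + 1) *\<^sub>R w = a + s *\<^sub>R w" for s
    by (simp add: b_def algebra_simps)
  then have "(\<lambda>u. D (b + u *\<^sub>R w) v) \<circ> (\<lambda>s. s - t + 1) = (\<lambda>s. D (a + s *\<^sub>R w) v)"
    by (simp only: o_def)
  moreover have "b + 0 *\<^sub>R v + 1 *\<^sub>R w = a + t *\<^sub>R w"
    by (simp add: b_def algebra_simps)
  then have "1 *\<^sub>R f 0 1 = F' (\<Phi> (a + t *\<^sub>R w)) (D (a + t *\<^sub>R w) v)"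
    by (simp only: f_def scaleR_one)
  ultimately show ?thesis
    by (simp only:)
qed

text \<open>The derivative in \<open>\<sigma>\<close> of the integral of \<open>F\<close> is the integral of \<open>\<kappa>\<close>, which telescopes to a
  difference of two values of \<open>G\<close>; hence the bound does not depend on \<open>t\<close>.\<close>

lemma integral_along_shifted_line:
  fixes F G \<kappa> :: "'a::real_normed_vector \<Rightarrow> real"
  assumes G: "\<And>b t. ((\<lambda>t. G (b + t *\<^sub>R w)) has_real_derivative \<kappa> (b + t *\<^sub>R w)) (at t)"
    and F: "\<And>b t. ((\<lambda>t. F (b + t *\<^sub>R v)) has_real_derivative \<kappa> (b + t *\<^sub>R v)) (at t)"
    and cont: "continuous_on UNIV F" "continuous_on UNIV \<kappa>"
    and M: "\<And>b. \<bar>G b\<bar> \<le> M" and "0 \<le> t"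
  shows "\<bar>integral {0..t} (\<lambda>s. F (b + \<sigma> *\<^sub>R v + s *\<^sub>R w)) - integral {0..t} (\<lambda>s. F (b + s *\<^sub>R w))\<bar>
           \<le> 2 * M * \<bar>\<sigma>\<bar>"
proof -
  define I where "I \<sigma> = integral (cbox 0 t) (\<lambda>s. F (b + \<sigma> *\<^sub>R v + s *\<^sub>R w))" for \<sigma>
  have deriv_I: "(I has_real_derivative integral (cbox 0 t) (\<lambda>s. \<kappa> (b + \<sigma> *\<^sub>R v + s *\<^sub>R w))) (at \<sigma> within UNIV)" for \<sigma>
    unfolding I_def
  proof (rule leibniz_rule_field_derivative)
    fix \<sigma> s :: real
    show "((\<lambda>\<sigma>. F (b + \<sigma> *\<^sub>R v + s *\<^sub>R w)) has_real_derivative \<kappa> (b + \<sigma> *\<^sub>R v + s *\<^sub>R w)) (at \<sigma> within UNIV)"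
      using F[of "b + s *\<^sub>R w" \<sigma>] by (simp add: ac_simps)
    show "(\<lambda>s. F (b + \<sigma> *\<^sub>R v + s *\<^sub>R w)) integrable_on cbox 0 t"
      by (intro integrable_continuous continuous_on_compose2[OF cont(1)] continuous_intros) auto
  next
    show "continuous_on (UNIV \<times> cbox 0 t) (\<lambda>(\<sigma>, s). \<kappa> (b + \<sigma> *\<^sub>R v + s *\<^sub>R w))"
      unfolding case_prod_unfold
      by (intro continuous_on_compose2[OF cont(2)] continuous_intros) auto
  qed auto
  have "((\<lambda>s. \<kappa> (b + \<sigma> *\<^sub>R v + s *\<^sub>R w)) has_integral
      G (b + \<sigma> *\<^sub>R v + t *\<^sub>R w) - G (b + \<sigma> *\<^sub>R v + 0 *\<^sub>R w)) {0..t}" for \<sigma>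
    by (rule fundamental_theorem_of_calculus[OF \<open>0 \<le> t\<close>])
      (rule has_vector_derivative_at_within[OF G[unfolded has_real_derivative_iff_has_vector_derivative]])
  then have "integral (cbox 0 t) (\<lambda>s. \<kappa> (b + \<sigma> *\<^sub>R v + s *\<^sub>R w)) =
      G (b + \<sigma> *\<^sub>R v + t *\<^sub>R w) - G (b + \<sigma> *\<^sub>R v)" for \<sigma>
    using integral_unique by fastforce
  then have "norm (integral (cbox 0 t) (\<lambda>s. \<kappa> (b + \<sigma> *\<^sub>R v + s *\<^sub>R w))) \<le> 2 * M" for \<sigma>
    using M[of "b + \<sigma> *\<^sub>R v + t *\<^sub>R w"] M[of "b + \<sigma> *\<^sub>R v"] by simp
  from field_differentiable_bound[OF convex_UNIV deriv_I this, of \<sigma> 0]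
  show ?thesis
    by (simp add: I_def)
qed

text \<open>At the times when the first coordinate meets \<open>c1\<close> modulo 2 pi, the second
  coordinate runs through an orbit of the circle rotation by 2 pi \<theta>. Rational independence
  makes \<theta> irrational, so this orbit is dense modulo 2 pi.\<close>

lemma winding_line_dense:
  assumes "rationally_independent \<omega>1 \<omega>2" and "closed C"
    and mem: "\<And>(t::real) (m::int) (n::int).
      (a1 + \<omega>1 * t + 2 * pi * of_int m, a2 + \<omega>2 * t + 2 * pi * of_int n) \<in> C"
  shows "(c1, c2) \<in> C"
proof -
  have "\<omega>1 \<noteq> 0"
    using assms(1) unfolding rationally_independent_def
    by (metis Rats_0 Rats_1 add.right_neutral mult_zero_left mult_zero_right zero_neq_one)
  define \<theta> where "\<theta> = \<omega>2 / \<omega>1"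
  have "\<theta> \<notin> \<rat>"
  proof
    assume "\<theta> \<in> \<rat>"
    moreover have "\<theta> * \<omega>1 + (- 1) * \<omega>2 = 0"
      using \<open>\<omega>1 \<noteq> 0\<close> by (simp add: \<theta>_def)
    moreover have "(-1::real) \<in> \<rat>" by simp
    ultimately show False
      using assms(1) unfolding rationally_independent_def by (metis neg_equal_0_iff_equal zero_neq_one)
  qed
  have "\<exists>y\<in>C. dist y (c1, c2) < e" if "e > 0" for e
  proof -
    \<comment> \<open>The target for the fractional parts: the gap left in the second coordinate, in
      units of 2 pi, when the line first reaches \<open>c1\<close> without any winding
      (\<open>k = 0\<close>).\<close>
    define \<alpha> where "\<alpha> = (c2 - a2 - \<theta> * (c1 - a1)) / (2 * pi)"
    have "e / (2 * pi) > 0"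
      using that by simp
    then obtain h k where hk: "\<bar>of_int k * \<theta> - of_int h - \<alpha>\<bar> < e / (2 * pi)"
      using sequence_of_fractional_parts_is_dense[OF \<open>\<theta> \<notin> \<rat>\<close>] by metis
    define t where "t = (c1 - a1 + 2 * pi * of_int k) / \<omega>1"
    let ?y = "(a1 + \<omega>1 * t + 2 * pi * of_int (- k), a2 + \<omega>2 * t + 2 * pi * of_int (- h))"
    have "fst ?y = c1"
      using \<open>\<omega>1 \<noteq> 0\<close> by (simp add: t_def)
    moreover have "snd ?y - c2 = 2 * pi * (of_int k * \<theta> - of_int h - \<alpha>)"
      using \<open>\<omega>1 \<noteq> 0\<close> by (simp add: t_def \<alpha>_def \<theta>_def field_simps)
    ultimately have "dist ?y (c1, c2) = 2 * pi * \<bar>of_int k * \<theta> - of_int h - \<alpha>\<bar>"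
      by (simp add: dist_prod_def dist_real_def abs_mult)
    also have "\<dots> < e"
      using hk by (simp add: field_simps)
    finally show ?thesis
      using mem by blast
  qed
  then show ?thesis
    using closed_approachable[OF \<open>closed C\<close>] by blast
qed

subsection \<open>The two commuting fields\<close>

lemma has_vector_derivative_prod_iff:
  "(z has_vector_derivative v) (at t within S) \<longleftrightarrow>
     ((\<lambda>t. fst (z t)) has_vector_derivative fst v) (at t within S) \<and> ((\<lambda>t. snd (z t)) has_vector_derivative snd v) (at t within S)"
proof
  assume "(z has_vector_derivative v) (at t within S)"
  then show "((\<lambda>t. fst (z t)) has_vector_derivative fst v) (at t within S) \<and>
      ((\<lambda>t. snd (z t)) has_vector_derivative snd v) (at t within S)"
    by (auto intro: bounded_linear.has_vector_derivative bounded_linear_fst bounded_linear_snd)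
next
  assume "((\<lambda>t. fst (z t)) has_vector_derivative fst v) (at t within S) \<and>
      ((\<lambda>t. snd (z t)) has_vector_derivative snd v) (at t within S)"
  then show "(z has_vector_derivative v) (at t within S)"
    using has_derivative_Pair[of "\<lambda>t. fst (z t)" "\<lambda>s. s *\<^sub>R fst v" t S "\<lambda>t. snd (z t)" "\<lambda>s. s *\<^sub>R snd v"]
    by (cases v) (simp add: has_vector_derivative_def)
qed

lemma has_vector_derivative_phase_iff:
  "(z has_vector_derivative v) (at t) \<longleftrightarrow>
     ((\<lambda>t. fst (z t)) has_real_derivative fst v) (at t) \<and>
     ((\<lambda>t. fst (snd (z t))) has_real_derivative fst (snd v)) (at t) \<and>
     ((\<lambda>t. fst (snd (snd (z t)))) has_real_derivative fst (snd (snd v))) (at t) \<and>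
     ((\<lambda>t. fst (snd (snd (snd (z t))))) has_real_derivative fst (snd (snd (snd v)))) (at t) \<and>
     ((\<lambda>t. fst (snd (snd (snd (snd (z t)))))) has_real_derivative fst (snd (snd (snd (snd v))))) (at t) \<and>
     ((\<lambda>t. snd (snd (snd (snd (snd (z t)))))) has_real_derivative snd (snd (snd (snd (snd v))))) (at t)"
  for z :: "real \<Rightarrow> phase"
  by (simp add: has_vector_derivative_prod_iff has_real_derivative_iff_has_vector_derivative)

lemma phase_curve_derivatives:
  fixes z :: "real \<Rightarrow> phase"
  assumes "(z has_vector_derivative v) (at t)"
  obtains p q r g1 g2 g3 p' q' r' g1' g2' g3'
  where "z = (\<lambda>s. (p s, q s, r s, g1 s, g2 s, g3 s))" "v = (p', q', r', g1', g2', g3')"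
    "(p has_real_derivative p') (at t)" "(q has_real_derivative q') (at t)"
    "(r has_real_derivative r') (at t)" "(g1 has_real_derivative g1') (at t)"
    "(g2 has_real_derivative g2') (at t)" "(g3 has_real_derivative g3') (at t)"
proof
  show "z = (\<lambda>s. (fst (z s), fst (snd (z s)), fst (snd (snd (z s))), fst (snd (snd (snd (z s)))),
      fst (snd (snd (snd (snd (z s))))), snd (snd (snd (snd (snd (z s)))))))" by simp
  show "v = (fst v, fst (snd v), fst (snd (snd v)), fst (snd (snd (snd v))),
      fst (snd (snd (snd (snd v)))), snd (snd (snd (snd (snd v)))))" by simp
qed (use assms in \<open>simp_all add: has_vector_derivative_phase_iff\<close>)

fun field_derivative :: "phase \<Rightarrow> phase \<Rightarrow> phase" where
  "field_derivative (p, q, r, \<gamma>1, \<gamma>2, \<gamma>3) (p', q', r', \<gamma>1', \<gamma>2', \<gamma>3') =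
     ((q' * r + q * r') / 2, (\<gamma>3' - r' * p - r * p') / 2, - \<gamma>2',
      r' * \<gamma>2 + r * \<gamma>2' - q' * \<gamma>3 - q * \<gamma>3', p' * \<gamma>3 + p * \<gamma>3' - r' * \<gamma>1 - r * \<gamma>1',
      q' * \<gamma>1 + q * \<gamma>1' - p' * \<gamma>2 - p * \<gamma>2')"

lemma kovalevskaya_field_eq:
  "kovalevskaya_field z =
    (fst (snd z) * fst (snd (snd z)) / 2,
     (snd (snd (snd (snd (snd z)))) - fst (snd (snd z)) * fst z) / 2,
     - fst (snd (snd (snd (snd z)))),
     fst (snd (snd z)) * fst (snd (snd (snd (snd z)))) - fst (snd z) * snd (snd (snd (snd (snd z)))),
     fst z * snd (snd (snd (snd (snd z)))) - fst (snd (snd z)) * fst (snd (snd (snd z))),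
     fst (snd z) * fst (snd (snd (snd z))) - fst z * fst (snd (snd (snd (snd z)))))"
  by (cases z rule: kovalevskaya_field.cases) simp

lemma kovalevskaya_field_has_derivative:
  "(kovalevskaya_field has_derivative field_derivative z) (at z)"
  unfolding kovalevskaya_field_eq[abs_def]
  by (rule derivative_eq_intros refl | simp)+
    (cases z rule: kovalevskaya_field.cases, auto simp: fun_eq_iff algebra_simps add_divide_distrib diff_divide_distrib)

text \<open>The Hamiltonian field of half the Kovalevskaya integral for the Lie-Poisson structure of the
  problem, with angular momentum \<open>(2p, 2q, r)\<close>; \<open>(n1, n2, 0)\<close> is the derivative of that function in
  the angular momentum and plays the role of the angular velocity.\<close>

fun second_field :: "phase \<Rightarrow> phase" where
  "second_field (p, q, r, \<gamma>1, \<gamma>2, \<gamma>3) =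
     (let u = p\<^sup>2 - q\<^sup>2 - \<gamma>1; v = 2 * p * q - \<gamma>2; n1 = p * u + q * v; n2 = p * v - q * u
      in ((\<gamma>3 * v - r * n2) / 2, (r * n1 - \<gamma>3 * u) / 2,
          2 * (p * n2 - q * n1) - \<gamma>1 * v + \<gamma>2 * u,
          - \<gamma>3 * n2, \<gamma>3 * n1, \<gamma>1 * n2 - \<gamma>2 * n1))"

text \<open>The rate of the precession angle along \<open>second_field\<close>: \<^const>\<open>precession_rate\<close> with \<open>(n1, n2)\<close> in
  place of \<open>(p, q)\<close>.\<close>

fun second_rate :: "phase \<Rightarrow> real" where
  "second_rate (p, q, r, \<gamma>1, \<gamma>2, \<gamma>3) =
     (let u = p\<^sup>2 - q\<^sup>2 - \<gamma>1; v = 2 * p * q - \<gamma>2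
      in ((p * u + q * v) * \<gamma>1 + (p * v - q * u) * \<gamma>2) / (\<gamma>1\<^sup>2 + \<gamma>2\<^sup>2))"

fun horizontal_square :: "phase \<Rightarrow> real" where
  "horizontal_square (p, q, r, \<gamma>1, \<gamma>2, \<gamma>3) = \<gamma>1\<^sup>2 + \<gamma>2\<^sup>2"

fun rate_derivative :: "phase \<Rightarrow> phase \<Rightarrow> real" where
  "rate_derivative (p, q, r, \<gamma>1, \<gamma>2, \<gamma>3) (p', q', r', \<gamma>1', \<gamma>2', \<gamma>3') =
     ((p' * \<gamma>1 + p * \<gamma>1' + q' * \<gamma>2 + q * \<gamma>2') * (\<gamma>1\<^sup>2 + \<gamma>2\<^sup>2)
      - (p * \<gamma>1 + q * \<gamma>2) * (2 * \<gamma>1 * \<gamma>1' + 2 * \<gamma>2 * \<gamma>2')) / (\<gamma>1\<^sup>2 + \<gamma>2\<^sup>2)\<^sup>2"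

text \<open>This says that the two fields commute.\<close>

lemma second_field_along_solution:
  assumes "(z has_vector_derivative kovalevskaya_field (z t)) (at t)"
  shows "((\<lambda>t. second_field (z t)) has_vector_derivative
           field_derivative (z t) (second_field (z t))) (at t)"
proof -
  from phase_curve_derivatives[OF assms] obtain p q r g1 g2 g3 p' q' r' g1' g2' g3'
    where z: "z = (\<lambda>s. (p s, q s, r s, g1 s, g2 s, g3 s))"
      and v: "kovalevskaya_field (z t) = (p', q', r', g1', g2', g3')"
      and [derivative_intros]: "(p has_real_derivative p') (at t)" "(q has_real_derivative q') (at t)"
      "(r has_real_derivative r') (at t)" "(g1 has_real_derivative g1') (at t)"
      "(g2 has_real_derivative g2') (at t)" "(g3 has_real_derivative g3') (at t)" .
  have v': "p' = q t * r t / 2" "q' = (g3 t - r t * p t) / 2" "r' = - g2 t"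
    "g1' = r t * g2 t - q t * g3 t" "g2' = p t * g3 t - r t * g1 t" "g3' = q t * g1 t - p t * g2 t"
    using v by (simp_all add: z)
  show ?thesis
    unfolding has_vector_derivative_phase_iff z second_field.simps Let_def fst_conv snd_conv field_derivative.simps
    by (intro conjI; (rule DERIV_cong, (rule derivative_intros)+, simp_all only: v',
          simp_all add: field_simps power2_eq_square))
qed

lemma precession_rate_has_derivative:
  assumes "(z has_vector_derivative v) (at t)" "horizontal_square (z t) \<noteq> 0"
  shows "((\<lambda>t. precession_rate (z t)) has_real_derivative rate_derivative (z t) v) (at t)"
proof -
  from phase_curve_derivatives[OF assms(1)] obtain p q r g1 g2 g3 p' q' r' g1' g2' g3'
    where z: "z = (\<lambda>s. (p s, q s, r s, g1 s, g2 s, g3 s))"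
      and v: "v = (p', q', r', g1', g2', g3')"
      and [derivative_intros]: "(p has_real_derivative p') (at t)" "(q has_real_derivative q') (at t)"
      "(r has_real_derivative r') (at t)" "(g1 has_real_derivative g1') (at t)"
      "(g2 has_real_derivative g2') (at t)" "(g3 has_real_derivative g3') (at t)" .
  show ?thesis
    using assms(2) unfolding z v precession_rate.simps rate_derivative.simps horizontal_square.simps
    by (auto intro!: derivative_eq_intros simp: algebra_simps power2_eq_square)
qed

text \<open>The identity between cross derivatives from the idea of the proof. Both rates are
  derivatives of one angle along motions of the body that commute, so the order of differentiation
  does not matter.\<close>

lemma second_rate_along_solution:
  assumes "(z has_vector_derivative kovalevskaya_field (z t)) (at t)" "horizontal_square (z t) \<noteq> 0"
  shows "((\<lambda>t. second_rate (z t)) has_real_derivative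
           rate_derivative (z t) (second_field (z t))) (at t)"
proof -
  from phase_curve_derivatives[OF assms(1)] obtain p q r g1 g2 g3 p' q' r' g1' g2' g3'
    where z: "z = (\<lambda>s. (p s, q s, r s, g1 s, g2 s, g3 s))"
      and v: "kovalevskaya_field (z t) = (p', q', r', g1', g2', g3')"
      and [derivative_intros]: "(p has_real_derivative p') (at t)" "(q has_real_derivative q') (at t)"
      "(r has_real_derivative r') (at t)" "(g1 has_real_derivative g1') (at t)"
      "(g2 has_real_derivative g2') (at t)" "(g3 has_real_derivative g3') (at t)" .
  have v': "p' = q t * r t / 2" "q' = (g3 t - r t * p t) / 2" "r' = - g2 t"
    "g1' = r t * g2 t - q t * g3 t" "g2' = p t * g3 t - r t * g1 t" "g3' = q t * g1 t - p t * g2 t"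
    using v by (simp_all add: z)
  have nonzero: "(g1 t)\<^sup>2 + (g2 t)\<^sup>2 \<noteq> 0"
    using assms(2) by (simp add: z)
  show ?thesis
    unfolding z second_rate.simps rate_derivative.simps second_field.simps Let_def
    apply (rule DERIV_cong, (rule derivative_intros nonzero)+)
    apply (simp add: v')
    \<comment> \<open>Comparing numerators and denominators separately leaves polynomial
      identities.\<close>
    apply (rule arg_cong2[where f="(/)"])
     apply (simp_all add: field_simps power2_eq_square)
    done
qed

subsection \<open>Level sets and reflection\<close>

lemma precession_rate_continuous_on:
  "continuous_on {z. horizontal_square z \<noteq> 0} precession_rate"
proof -
  have eq: "precession_rate = (\<lambda>(p, q, r, \<gamma>1, \<gamma>2, \<gamma>3). (p * \<gamma>1 + q * \<gamma>2) / (\<gamma>1\<^sup>2 + \<gamma>2\<^sup>2))"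
    by auto
  show ?thesis
    unfolding eq by (auto simp: case_prod_unfold intro!: continuous_intros)
qed

lemma second_rate_continuous_on:
  "continuous_on {z. horizontal_square z \<noteq> 0} second_rate"
proof -
  have eq: "second_rate = (\<lambda>(p, q, r, \<gamma>1, \<gamma>2, \<gamma>3).
      ((p * (p\<^sup>2 - q\<^sup>2 - \<gamma>1) + q * (2 * p * q - \<gamma>2)) * \<gamma>1
        + (p * (2 * p * q - \<gamma>2) - q * (p\<^sup>2 - q\<^sup>2 - \<gamma>1)) * \<gamma>2) / (\<gamma>1\<^sup>2 + \<gamma>2\<^sup>2))"
    by (auto simp: Let_def)
  show ?thesis
    unfolding eq by (auto simp: case_prod_unfold intro!: continuous_intros)
qed

lemma rate_derivative_continuous_on:
  assumes "continuous_on S V" "S \<subseteq> {z. horizontal_square z \<noteq> 0}"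
  shows "continuous_on S (\<lambda>z. rate_derivative z (V z))"
proof -
  have "rate_derivative z v = (case (z, v) of ((p, q, r, \<gamma>1, \<gamma>2, \<gamma>3), (p', q', r', \<gamma>1', \<gamma>2', \<gamma>3')) \<Rightarrow>
     ((p' * \<gamma>1 + p * \<gamma>1' + q' * \<gamma>2 + q * \<gamma>2') * (\<gamma>1\<^sup>2 + \<gamma>2\<^sup>2)
      - (p * \<gamma>1 + q * \<gamma>2) * (2 * \<gamma>1 * \<gamma>1' + 2 * \<gamma>2 * \<gamma>2')) / (\<gamma>1\<^sup>2 + \<gamma>2\<^sup>2)\<^sup>2)" for z v
    by (cases "(z, v)" rule: rate_derivative.cases) simp
  then show ?thesis
    using assms by (auto simp: case_prod_unfold intro!: continuous_intros)
qed

lemma kovalevskaya_field_continuous_on: "continuous_on S kovalevskaya_field"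
  by (intro continuous_at_imp_continuous_on ballI has_derivative_continuous[OF kovalevskaya_field_has_derivative])

lemma second_field_continuous_on: "continuous_on S second_field"
proof -
  have eq: "second_field = (\<lambda>(p, q, r, \<gamma>1, \<gamma>2, \<gamma>3).
     let u = p\<^sup>2 - q\<^sup>2 - \<gamma>1; v = 2 * p * q - \<gamma>2; n1 = p * u + q * v; n2 = p * v - q * u
      in ((\<gamma>3 * v - r * n2) / 2, (r * n1 - \<gamma>3 * u) / 2,
          2 * (p * n2 - q * n1) - \<gamma>1 * v + \<gamma>2 * u,
          - \<gamma>3 * n2, \<gamma>3 * n1, \<gamma>1 * n2 - \<gamma>2 * n1))"
    by auto
  show ?thesis
    unfolding eq by (auto simp: case_prod_unfold Let_def intro!: continuous_intros)
qed

lemma field_derivative_continuous_on: "continuous_on S (\<lambda>(z, v). field_derivative z v)"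
proof -
  have "(\<lambda>(z, v). field_derivative z v) =
     (\<lambda>((p, q, r, \<gamma>1, \<gamma>2, \<gamma>3), (p', q', r', \<gamma>1', \<gamma>2', \<gamma>3')).
     ((q' * r + q * r') / 2, (\<gamma>3' - r' * p - r * p') / 2, - \<gamma>2',
      r' * \<gamma>2 + r * \<gamma>2' - q' * \<gamma>3 - q * \<gamma>3', p' * \<gamma>3 + p * \<gamma>3' - r' * \<gamma>1 - r * \<gamma>1',
      q' * \<gamma>1 + q * \<gamma>1' - p' * \<gamma>2 - p * \<gamma>2'))"
    by auto
  then show ?thesis
    by (auto simp: case_prod_unfold intro!: continuous_intros)
qed

section \<open>Lipschitz estimate and uniqueness of solutions\<close>

lemma norm_field_derivative_le:
  assumes "norm z \<le> R"
  shows "norm (field_derivative z v) \<le> (14 * R + 2) * norm v"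
proof (cases "(z, v)" rule: field_derivative.cases)
  case (1 p q r \<gamma>1 \<gamma>2 \<gamma>3 p' q' r' \<gamma>1' \<gamma>2' \<gamma>3')
  define n where "n = norm v"
  have z: "z = (p, q, r, \<gamma>1, \<gamma>2, \<gamma>3)" and v: "v = (p', q', r', \<gamma>1', \<gamma>2', \<gamma>3')"
    using 1 by auto
  have comp: "\<bar>a1\<bar> \<le> N \<and> \<bar>a2\<bar> \<le> N \<and> \<bar>a3\<bar> \<le> N \<and> \<bar>a4\<bar> \<le> N \<and> \<bar>a5\<bar> \<le> N \<and> \<bar>a6\<bar> \<le> N"
    if "norm (a1, a2, a3, a4, a5, a6) \<le> N" for a1 a2 a3 a4 a5 a6 N :: real
    using that norm_fst_le[of a1 "(a2, a3, a4, a5, a6)"] norm_snd_le[of "(a2, a3, a4, a5, a6)" a1]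
      norm_fst_le[of a2 "(a3, a4, a5, a6)"] norm_snd_le[of "(a3, a4, a5, a6)" a2]
      norm_fst_le[of a3 "(a4, a5, a6)"] norm_snd_le[of "(a4, a5, a6)" a3]
      norm_fst_le[of a4 "(a5, a6)"] norm_snd_le[of "(a5, a6)" a4]
      norm_fst_le[of a5 a6] norm_snd_le[of a6 a5]
    by (simp only: real_norm_def) linarith
  have zc: "\<bar>p\<bar> \<le> R" "\<bar>q\<bar> \<le> R" "\<bar>r\<bar> \<le> R" "\<bar>\<gamma>1\<bar> \<le> R" "\<bar>\<gamma>2\<bar> \<le> R" "\<bar>\<gamma>3\<bar> \<le> R"
    using comp assms unfolding z by blast+
  have vc: "\<bar>p'\<bar> \<le> n" "\<bar>q'\<bar> \<le> n" "\<bar>r'\<bar> \<le> n" "\<bar>\<gamma>1'\<bar> \<le> n" "\<bar>\<gamma>2'\<bar> \<le> n" "\<bar>\<gamma>3'\<bar> \<le> n"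
    using comp[of p' q' r' \<gamma>1' \<gamma>2' \<gamma>3' n] unfolding n_def v by blast+
  have prod: "x * y \<le> R * n" "- (R * n) \<le> x * y" "y * x \<le> R * n" "- (R * n) \<le> y * x"
    if "\<bar>x\<bar> \<le> R" "\<bar>y\<bar> \<le> n" for x y
  proof -
    have "\<bar>x * y\<bar> \<le> R * n"
      using that unfolding abs_mult by (intro mult_mono) auto
    then show "x * y \<le> R * n" "- (R * n) \<le> x * y" "y * x \<le> R * n" "- (R * n) \<le> y * x"
      by (auto simp: mult.commute)
  qed
  have c1: "\<bar>(q' * r + q * r') / 2\<bar> \<le> R * n"
    using prod[OF zc(3) vc(2)] prod[OF zc(2) vc(3)] by simp
  have c2: "\<bar>(\<gamma>3' - r' * p - r * p') / 2\<bar> \<le> n / 2 + R * n"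
    using prod[OF zc(1) vc(3)] prod[OF zc(3) vc(1)] vc(6) by simp
  have c4: "\<bar>r' * \<gamma>2 + r * \<gamma>2' - q' * \<gamma>3 - q * \<gamma>3'\<bar> \<le> 4 * (R * n)"
    using prod[OF zc(5) vc(3)] prod[OF zc(3) vc(5)] prod[OF zc(6) vc(2)] prod[OF zc(2) vc(6)] by simp
  have c5: "\<bar>p' * \<gamma>3 + p * \<gamma>3' - r' * \<gamma>1 - r * \<gamma>1'\<bar> \<le> 4 * (R * n)"
    using prod[OF zc(6) vc(1)] prod[OF zc(1) vc(6)] prod[OF zc(4) vc(3)] prod[OF zc(3) vc(4)] by simp
  have c6: "\<bar>q' * \<gamma>1 + q * \<gamma>1' - p' * \<gamma>2 - p * \<gamma>2'\<bar> \<le> 4 * (R * n)"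
    using prod[OF zc(4) vc(2)] prod[OF zc(2) vc(4)] prod[OF zc(5) vc(1)] prod[OF zc(1) vc(5)] by simp
  have sum: "norm (a1, a2, a3, a4, a5, a6) \<le> \<bar>a1\<bar> + \<bar>a2\<bar> + \<bar>a3\<bar> + \<bar>a4\<bar> + \<bar>a5\<bar> + \<bar>a6\<bar>"
    for a1 a2 a3 a4 a5 a6 :: real
    using norm_Pair_le[of a1 "(a2, a3, a4, a5, a6)"] norm_Pair_le[of a2 "(a3, a4, a5, a6)"]
      norm_Pair_le[of a3 "(a4, a5, a6)"] norm_Pair_le[of a4 "(a5, a6)"] norm_Pair_le[of a5 a6]
    by (simp only: real_norm_def)
  have "0 \<le> n" "\<bar>- \<gamma>2'\<bar> \<le> n"
    using vc by (simp_all add: n_def)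
  \<comment> \<open>The six component bounds add up to \<open>14 * (R * n)\<close> and
    \<open>3 / 2 * n\<close>; the latter is rounded up.\<close>
  then have "norm (field_derivative z v) \<le> 14 * (R * n) + 2 * n"
    unfolding z v field_derivative.simps
    by (intro order.trans[OF sum]) (use c1 c2 c4 c5 c6 in linarith)
  then show ?thesis
    by (simp add: n_def algebra_simps)
qed

text \<open>The field is a polynomial of degree two, so the mean value formula with the derivative
  at the midpoint is exact. The midpoint stays in any ball containing both points, which gives a
  Lipschitz constant there.\<close>

lemma kovalevskaya_field_diff:
  "kovalevskaya_field z - kovalevskaya_field w = field_derivative ((1 / 2) *\<^sub>R (z + w)) (z - w)"
  by (cases z rule: kovalevskaya_field.cases; cases w rule: kovalevskaya_field.cases)
    (simp add: field_simps)

lemma kovalevskaya_solution_unique: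
  assumes x: "kovalevskaya_solution x" and y: "kovalevskaya_solution y"
    and bounds: "\<And>t. norm (x t) \<le> R" "\<And>t. norm (y t) \<le> R" and "x 0 = y 0"
  shows "x t = y t"
proof -
  have "x t - y t = 0"
  proof (rule zero_if_linear_growth)
    fix s
    show "((\<lambda>t. x t - y t) has_vector_derivative kovalevskaya_field (x s) - kovalevskaya_field (y s)) (at s)"
      using x y unfolding kovalevskaya_solution_def by (intro has_vector_derivative_diff) auto
    have "norm ((1 / 2) *\<^sub>R (x s + y s)) \<le> R"
      using norm_triangle_ineq[of "x s" "y s"] bounds[of s] by simp
    then show "norm (kovalevskaya_field (x s) - kovalevskaya_field (y s)) \<le> (14 * R + 2) * norm (x s - y s)"
      unfolding kovalevskaya_field_diff by (rule norm_field_derivative_le)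
  qed (simp add: \<open>x 0 = y 0\<close>)
  then show ?thesis
    by simp
qed

section \<open>Compactness of the levels and the nonvanishing denominator\<close>

lemma zero_area_level_iff:
  "(p, q, r, \<gamma>1, \<gamma>2, \<gamma>3) \<in> zero_area_level K h \<longleftrightarrow>
     \<gamma>1\<^sup>2 + \<gamma>2\<^sup>2 + \<gamma>3\<^sup>2 = 1 \<and> 2 * (p * \<gamma>1 + q * \<gamma>2) + r * \<gamma>3 = 0 \<and>
     p\<^sup>2 + q\<^sup>2 + r\<^sup>2 / 2 + \<gamma>1 = h \<and> (p\<^sup>2 - q\<^sup>2 - \<gamma>1)\<^sup>2 + (2 * p * q - \<gamma>2)\<^sup>2 = K"
  by (simp add: zero_area_level_def)

lemma norm_zero_area_level_le:
  assumes "z \<in> zero_area_level K h"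
  shows "norm z \<le> sqrt (2 * h + 3)"
proof (cases z rule: kovalevskaya_field.cases)
  case (1 p q r \<gamma>1 \<gamma>2 \<gamma>3)
  have geo: "\<gamma>1\<^sup>2 + \<gamma>2\<^sup>2 + \<gamma>3\<^sup>2 = 1" and en: "p\<^sup>2 + q\<^sup>2 + r\<^sup>2 / 2 + \<gamma>1 = h"
    using assms unfolding 1 zero_area_level_iff by auto
  have "\<gamma>1\<^sup>2 \<le> 1"
    using geo zero_le_power2[of \<gamma>2] zero_le_power2[of \<gamma>3] by linarith
  then have "\<bar>\<gamma>1\<bar> \<le> 1"
    by (simp add: abs_square_le_1)
  \<comment> \<open>Twice the energy equation bounds the first three squares by
    \<open>2 * h + 2\<close>, because \<open>\<gamma>1\<close> is at least -1; the other three
    squares add up to 1.\<close>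
  then have "p\<^sup>2 + (q\<^sup>2 + (r\<^sup>2 + (\<gamma>1\<^sup>2 + (\<gamma>2\<^sup>2 + \<gamma>3\<^sup>2)))) \<le> 2 * h + 3"
    using geo en zero_le_power2[of p] zero_le_power2[of q] by linarith
  then show ?thesis
    by (simp add: 1 norm_Pair)
qed

lemma compact_zero_area_level: "compact (zero_area_level K h)"
proof -
  have "zero_area_level K h =
      {z. (\<lambda>(p, q, r, \<gamma>1, \<gamma>2, \<gamma>3). \<gamma>1\<^sup>2 + \<gamma>2\<^sup>2 + \<gamma>3\<^sup>2) z = 1} \<inter>
      {z. (\<lambda>(p, q, r, \<gamma>1, \<gamma>2, \<gamma>3). 2 * (p * \<gamma>1 + q * \<gamma>2) + r * \<gamma>3) z = 0} \<inter>
      {z. (\<lambda>(p, q, r, \<gamma>1, \<gamma>2, \<gamma>3). p\<^sup>2 + q\<^sup>2 + r\<^sup>2 / 2 + \<gamma>1) z = h} \<inter>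
      {z. (\<lambda>(p, q, r, \<gamma>1, \<gamma>2, \<gamma>3). (p\<^sup>2 - q\<^sup>2 - \<gamma>1)\<^sup>2 + (2 * p * q - \<gamma>2)\<^sup>2) z = K}"
    by (auto simp: zero_area_level_def)
  also have "closed \<dots>"
    unfolding case_prod_unfold
    by (intro closed_Int; rule closed_Collect_eq) (simp_all add: continuous_intros)
  finally have "closed (zero_area_level K h)" .
  moreover have "bounded (zero_area_level K h)"
    by (rule boundedI[OF norm_zero_area_level_le])
  ultimately show ?thesis
    by (simp add: compact_eq_bounded_closed)
qed

lemma horizontal_square_nonzero:
  assumes "z \<in> zero_area_level K h" "(K, h) \<in> region_O1"
  shows "horizontal_square z \<noteq> 0"
proof (cases z rule: kovalevskaya_field.cases)
  case (1 p q r \<gamma>1 \<gamma>2 \<gamma>3)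
  show ?thesis
  proof
    assume "horizontal_square z = 0"
    then have "\<gamma>1 = 0" "\<gamma>2 = 0"
      by (simp_all add: 1 sum_power2_eq_zero_iff)
    moreover from this have "r = 0"
      using assms(1) by (auto simp: 1 zero_area_level_iff)
    \<comment> \<open>Here the energy is \<open>p\<^sup>2 + q\<^sup>2\<close> and the Kovalevskaya
      integral is the square of that.\<close>
    ultimately have "K = h\<^sup>2"
      using assms(1) by (auto simp: 1 zero_area_level_iff power2_eq_square algebra_simps)
    then show False
      using assms(2) by (simp add: region_O1_def)
  qed
qed

section \<open>The reflection symmetry\<close>

fun reflection :: "phase \<Rightarrow> phase" where
  "reflection (p, q, r, \<gamma>1, \<gamma>2, \<gamma>3) = (- p, - q, r, \<gamma>1, \<gamma>2, - \<gamma>3)"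

lemma reflection_solution:
  assumes "kovalevskaya_solution x"
  shows "kovalevskaya_solution (\<lambda>t. reflection (x t))"
  unfolding kovalevskaya_solution_def
proof
  fix t
  have "(x has_vector_derivative kovalevskaya_field (x t)) (at t)"
    using assms by (simp add: kovalevskaya_solution_def)
  moreover have "bounded_linear reflection"
  proof -
    have "linear reflection"
      by (rule linearI) (auto simp: algebra_simps)
    then show ?thesis
      by (simp add: linear_conv_bounded_linear)
  qed
  ultimately have "((\<lambda>t. reflection (x t)) has_vector_derivative reflection (kovalevskaya_field (x t))) (at t)"
    by (rule bounded_linear.has_vector_derivative[rotated])
  moreover have "reflection (kovalevskaya_field (x t)) = kovalevskaya_field (reflection (x t))"
    by (cases "x t" rule: reflection.cases) (simp add: field_simps)
  ultimately show "((\<lambda>t. reflection (x t)) has_vector_derivative kovalevskaya_field (reflection (x t))) (at t)"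
    by simp
qed

lemma reflection_zero_area_level:
  "z \<in> zero_area_level K h \<Longrightarrow> reflection z \<in> zero_area_level K h"
  by (cases z rule: reflection.cases) (auto simp: zero_area_level_iff)

lemma precession_rate_reflection: "precession_rate (reflection z) = - precession_rate z"
  by (cases z rule: reflection.cases) (simp add: add_divide_distrib diff_divide_distrib)

section \<open>Tangent vectors at an explicit point of the level\<close>

lemma tangent_equations:
  fixes z :: "real \<Rightarrow> phase"
  assumes "\<And>t. z t \<in> zero_area_level K h"
    and "(z has_vector_derivative (p', q', r', \<gamma>1', \<gamma>2', \<gamma>3')) (at t)"
    and "z t = (p, q, r, \<gamma>1, \<gamma>2, \<gamma>3)"
  shows "\<gamma>1 * \<gamma>1' + \<gamma>2 * \<gamma>2' + \<gamma>3 * \<gamma>3' = 0"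
    and "2 * (p' * \<gamma>1 + p * \<gamma>1' + q' * \<gamma>2 + q * \<gamma>2') + r' * \<gamma>3 + r * \<gamma>3' = 0"
    and "2 * p * p' + 2 * q * q' + r * r' + \<gamma>1' = 0"
    and "(p\<^sup>2 - q\<^sup>2 - \<gamma>1) * (2 * p * p' - 2 * q * q' - \<gamma>1')
           + (2 * p * q - \<gamma>2) * (2 * (p' * q + p * q') - \<gamma>2') = 0"
proof -
  from phase_curve_derivatives[OF assms(2)] obtain P Q R G1 G2 G3 a1 a2 a3 a4 a5 a6
    where z: "z = (\<lambda>s. (P s, Q s, R s, G1 s, G2 s, G3 s))"
      and v: "(p', q', r', \<gamma>1', \<gamma>2', \<gamma>3') = (a1, a2, a3, a4, a5, a6)"
      and d: "(P has_real_derivative a1) (at t)" "(Q has_real_derivative a2) (at t)"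
      "(R has_real_derivative a3) (at t)" "(G1 has_real_derivative a4) (at t)"
      "(G2 has_real_derivative a5) (at t)" "(G3 has_real_derivative a6) (at t)" .
  have [derivative_intros]: "(P has_real_derivative p') (at t)" "(Q has_real_derivative q') (at t)"
      "(R has_real_derivative r') (at t)" "(G1 has_real_derivative \<gamma>1') (at t)"
      "(G2 has_real_derivative \<gamma>2') (at t)" "(G3 has_real_derivative \<gamma>3') (at t)"
    using d v by simp_all
  have at_t: "P t = p" "Q t = q" "R t = r" "G1 t = \<gamma>1" "G2 t = \<gamma>2" "G3 t = \<gamma>3"
    using assms(3) by (simp_all add: z)
  \<comment> \<open>Each integral is constant along the curve, so its derivative vanishes. The
    energy equation is doubled to clear the fraction.\<close>
  have level: "(G1 s)\<^sup>2 + (G2 s)\<^sup>2 + (G3 s)\<^sup>2 = 1" "2 * (P s * G1 s + Q s * G2 s) + R s * G3 s = 0"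
    "2 * (P s)\<^sup>2 + 2 * (Q s)\<^sup>2 + (R s)\<^sup>2 + 2 * G1 s = 2 * h"
    "((P s)\<^sup>2 - (Q s)\<^sup>2 - G1 s)\<^sup>2 + (2 * P s * Q s - G2 s)\<^sup>2 = K" for s
    using assms(1)[of s] by (auto simp: z zero_area_level_iff)
  have const: "D = 0" if "(f has_real_derivative D) (at t)" "\<And>s. f s = c" for f D and c :: real
  proof -
    have "f = (\<lambda>_. c)"
      using that(2) by auto
    with that(1) show ?thesis
      using DERIV_unique[OF _ DERIV_const] by simp
  qed
  have "2 * (\<gamma>1 * \<gamma>1') + 2 * (\<gamma>2 * \<gamma>2') + 2 * (\<gamma>3 * \<gamma>3') = 0"
    by (rule const[OF _ level(1)], rule DERIV_cong, (rule derivative_intros)+) (simp add: at_t)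
  then show "\<gamma>1 * \<gamma>1' + \<gamma>2 * \<gamma>2' + \<gamma>3 * \<gamma>3' = 0"
    by linarith
  show "2 * (p' * \<gamma>1 + p * \<gamma>1' + q' * \<gamma>2 + q * \<gamma>2') + r' * \<gamma>3 + r * \<gamma>3' = 0"
    by (rule const[OF _ level(2)], rule DERIV_cong, (rule derivative_intros)+) (simp add: at_t algebra_simps)
  have "2 * (2 * p * p' + 2 * q * q' + r * r' + \<gamma>1') = 0"
    by (rule const[OF _ level(3)], rule DERIV_cong, (rule derivative_intros)+) (simp add: at_t algebra_simps)
  then show "2 * p * p' + 2 * q * q' + r * r' + \<gamma>1' = 0"
    by simp
  have "2 * ((p\<^sup>2 - q\<^sup>2 - \<gamma>1) * (2 * p * p' - 2 * q * q' - \<gamma>1')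
           + (2 * p * q - \<gamma>2) * (2 * (p' * q + p * q') - \<gamma>2')) = 0"
    by (rule const[OF _ level(4)], rule DERIV_cong, (rule derivative_intros)+) (simp add: at_t algebra_simps)
  then show "(p\<^sup>2 - q\<^sup>2 - \<gamma>1) * (2 * p * p' - 2 * q * q' - \<gamma>1')
           + (2 * p * q - \<gamma>2) * (2 * (p' * q + p * q') - \<gamma>2') = 0"
    by simp
qed

text \<open>At points with \<open>r = \<gamma>\<^sub>3 = 0\<close> the common kernel of the differentials of the four integrals is
  contained in the plane of \<open>r\<close> and \<open>\<gamma>\<^sub>3\<close>, which makes the independence of the two fields explicit.\<close>

lemma special_tangent_space:
  fixes c s m :: real
  assumes "c\<^sup>2 + s\<^sup>2 = 1" "c \<noteq> 0" "s \<noteq> 0" "m \<noteq> 0"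
    and z: "\<And>t. z t \<in> zero_area_level K h" "(z has_vector_derivative v) (at t)"
      "z t = (- m * s, m * c, 0, c, s, 0)"
  obtains \<rho> \<kappa> where "v = (0, 0, \<rho>, 0, 0, \<kappa>)"
proof (cases v rule: kovalevskaya_field.cases)
  case (1 p' q' r' \<gamma>1' \<gamma>2' \<gamma>3')
  note eqs = tangent_equations[OF z(1) z(2)[unfolded 1] z(3)]
  \<comment> \<open>The first tangent equation makes \<open>(\<gamma>1', \<gamma>2')\<close>
    orthogonal to the unit vector \<open>(c, s)\<close>, hence equal to \<tau> times
    \<open>(-s, c)\<close>. The multiple \<mu> absorbs the factor \<open>2 * m\<close> of the energy
    equation.\<close>
  define \<tau> where "\<tau> = c * \<gamma>2' - s * \<gamma>1'"
  define \<mu> where "\<mu> = \<tau> / (2 * m)"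
  have \<tau>: "\<tau> = 2 * m * \<mu>"
    using assms by (simp add: \<mu>_def)
  have g: "\<gamma>1' = - s * \<tau>" "\<gamma>2' = c * \<tau>"
    using eqs(1) assms(1) unfolding \<tau>_def by algebra+
  have "c * p' + s * q' = - m * \<tau>"
    using eqs(2) assms(1) unfolding g by algebra
  moreover have "m * (c * q' - s * p') = m * (s * \<mu>)"
    using eqs(3) unfolding g \<tau> by algebra
  then have "c * q' - s * p' = s * \<mu>"
    using assms by simp
  ultimately have pq: "p' = - m * c * \<tau> - s\<^sup>2 * \<mu>" "q' = - m * s * \<tau> + s * c * \<mu>"
    using assms(1) by algebra+
  \<comment> \<open>The first three equations express all velocities except \<open>r'\<close> and
    \<open>\<gamma>3'\<close> through \<tau>; the Kovalevskaya equation then forces \<tau> to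
    vanish.\<close>
  have "s * c * \<tau> = 0"
    using eqs(4) assms(1) unfolding g pq \<tau> by algebra
  then have "\<tau> = 0" "\<mu> = 0"
    using assms by (simp_all add: \<mu>_def)
  then have "v = (0, 0, r', 0, 0, \<gamma>3')"
    unfolding 1 g pq by simp
  then show ?thesis
    using that by blast
qed

text \<open>With \<open>r\<close> and \<open>\<gamma>3\<close> zero and \<open>(p, q)\<close> equal
  to \<open>m\<close> times the quarter turn of the unit vector \<open>(c, s)\<close>, the area
  integral vanishes. The other two integrals become \<open>h = m\<^sup>2 + c\<close> and
  \<open>K = h\<^sup>2 + s\<^sup>2\<close>, which are solved for \<open>s\<close>, \<open>c\<close>
  and \<open>m\<close>.\<close>

lemma special_point:
  assumes "(K, h) \<in> region_O1"
  obtains c s m :: real where "c\<^sup>2 + s\<^sup>2 = 1" "c \<noteq> 0" "s \<noteq> 0" "m \<noteq> 0"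
    "(- m * s, m * c, 0, c, s, 0) \<in> zero_area_level K h"
proof -
  have K: "h\<^sup>2 < K" "K < 1"
    using assms by (auto simp: region_O1_def)
  have "0 < 1 - K + h\<^sup>2"
    using K zero_le_power2[of h] by linarith
  \<comment> \<open>The negative root is taken so that \<open>h - c\<close>, the square of
    \<open>m\<close>, is positive: \<open>K < 1\<close> makes \<open>\<bar>h\<bar>\<close> smaller
    than this root in absolute value.\<close>
  define c where "c = - sqrt (1 - K + h\<^sup>2)"
  define s where "s = sqrt (K - h\<^sup>2)"
  define m where "m = sqrt (h - c)"
  have c2: "c\<^sup>2 = 1 - K + h\<^sup>2" and s2: "s\<^sup>2 = K - h\<^sup>2" and "s \<noteq> 0" "c \<noteq> 0"
    using K \<open>0 < 1 - K + h\<^sup>2\<close> by (simp_all add: c_def s_def)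
  have "\<bar>h\<bar> < sqrt (1 - K + h\<^sup>2)"
    using K by (intro real_less_rsqrt) simp
  then have "h - c > 0"
    unfolding c_def by linarith
  then have m2: "m\<^sup>2 = h - c" and "m \<noteq> 0"
    by (auto simp: m_def)
  have sum: "c\<^sup>2 + s\<^sup>2 = 1"
    by (simp add: c2 s2)
  have K_eq: "K = h\<^sup>2 + s\<^sup>2"
    by (simp add: s2)
  have h: "h = m\<^sup>2 + c"
    by (simp add: m2)
  have "(m * s)\<^sup>2 + (m * c)\<^sup>2 + c = h"
    using sum h by algebra
  moreover have "((m * s)\<^sup>2 - (m * c)\<^sup>2 - c)\<^sup>2 + (- (2 * m * s * (m * c)) - s)\<^sup>2 = K"
    using sum h K_eq by algebra
  ultimately have "(- m * s, m * c, 0, c, s, 0) \<in> zero_area_level K h"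
    using sum by (simp add: zero_area_level_iff algebra_simps)
  then show ?thesis
    using that sum \<open>c \<noteq> 0\<close> \<open>s \<noteq> 0\<close> \<open>m \<noteq> 0\<close> by blast
qed

text \<open>In the plane of \<open>r\<close> and \<open>\<gamma>3\<close> the two velocities have
  determinant \<open>- s * c * m\<close>, so they are independent at the points supplied by
  \<open>special_point\<close>.\<close>

lemma fields_at_special_point:
  fixes c s m :: real
  assumes "c\<^sup>2 + s\<^sup>2 = 1"
  shows "kovalevskaya_field (- m * s, m * c, 0, c, s, 0) = (0, 0, - s, 0, 0, m)"
    and "second_field (- m * s, m * c, 0, c, s, 0) = (0, 0, - m\<^sup>2 * s, 0, 0, m * (m\<^sup>2 + c))"
proof -
  show "kovalevskaya_field (- m * s, m * c, 0, c, s, 0) = (0, 0, - s, 0, 0, m)"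
    unfolding kovalevskaya_field.simps prod.inject
    by (insert assms, intro conjI; (simp; fail | algebra))
  show "second_field (- m * s, m * c, 0, c, s, 0) = (0, 0, - m\<^sup>2 * s, 0, 0, m * (m\<^sup>2 + c))"
    unfolding second_field.simps Let_def prod.inject
    by (insert assms, intro conjI; (simp; fail | algebra))
qed

subsection \<open>Angle coordinates\<close>

text \<open>At the special point the second field is tangent to the torus, say in the direction \<open>\<eta>\<close>. The field
  and the image of \<open>\<eta>\<close> satisfy the same variational equation, so they agree along the orbit of that
  point, and by density of the orbit everywhere.\<close>

lemma second_field_direction:
  assumes angles: "linearizing_angles (zero_area_level K h) \<Phi> \<omega>1 \<omega>2"
    and indep: "rationally_independent \<omega>1 \<omega>2" and O1: "(K, h) \<in> region_O1"
  obtains \<eta> where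
    "\<And>b t. ((\<lambda>t. \<Phi> (b + t *\<^sub>R \<eta>)) has_vector_derivative second_field (\<Phi> (b + t *\<^sub>R \<eta>))) (at t)"
    "\<And>d. \<exists>\<alpha> \<beta>. d = \<alpha> *\<^sub>R (\<omega>1, \<omega>2) + \<beta> *\<^sub>R \<eta>"
proof -
  define w where "w = (\<omega>1, \<omega>2)"
  have range: "range \<Phi> = zero_area_level K h"
    and period: "\<And>a1 a2 b1 b2. \<Phi> (a1, a2) = \<Phi> (b1, b2) \<longleftrightarrow>
        (\<exists>m n :: int. a1 - b1 = 2 * pi * of_int m \<and> a2 - b2 = 2 * pi * of_int n)"
    and solution: "\<And>a1 a2. kovalevskaya_solution (\<lambda>t. \<Phi> (a1 + \<omega>1 * t, a2 + \<omega>2 * t))"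
    using angles unfolding linearizing_angles_def by blast+
  obtain D :: "real \<times> real \<Rightarrow> (real \<times> real) \<Rightarrow>\<^sub>L phase" where cont_D: "continuous_on UNIV D"
    and D: "\<And>a. (\<Phi> has_derivative blinfun_apply (D a)) (at a)" and inj_D: "\<And>a. inj (blinfun_apply (D a))"
    using angles unfolding linearizing_angles_def by blast
  have cont_\<Phi>: "continuous_on UNIV \<Phi>"
    by (intro continuous_at_imp_continuous_on ballI has_derivative_continuous[OF D])
  have in_level: "\<Phi> b \<in> zero_area_level K h" for b
    using range by blast
  have line: "((\<lambda>t. \<Phi> (b + t *\<^sub>R v)) has_vector_derivative D (b + t *\<^sub>R v) v) (at t)" for b v t
    unfolding has_vector_derivative_def
    by (rule has_derivative_eq_rhs[OF has_derivative_compose[OF _ D]])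
      (auto intro!: derivative_eq_intros simp: blinfun.scaleR_right)
  have flow: "((\<lambda>t. \<Phi> (b + t *\<^sub>R w)) has_vector_derivative kovalevskaya_field (\<Phi> (b + t *\<^sub>R w))) (at t)" for b t
    using solution[of "fst b" "snd b"] unfolding kovalevskaya_solution_def
    by (cases b) (simp add: w_def mult.commute[of _ \<omega>1] mult.commute[of _ \<omega>2])
  obtain c s m :: real where csm: "c\<^sup>2 + s\<^sup>2 = 1" "c \<noteq> 0" "s \<noteq> 0" "m \<noteq> 0"
    and "(- m * s, m * c, 0, c, s, 0) \<in> zero_area_level K h"
    using special_point[OF O1] .
  then obtain a where a: "\<Phi> a = (- m * s, m * c, 0, c, s, 0)"
    using range by (metis imageE)
  \<comment> \<open>The components of the derivative at \<open>a\<close> that can be nonzero. By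
    dimension, the injective map \<open>L\<close> from the plane to the plane is onto, so the second
    field at \<open>a\<close> is the image of some direction \<eta>.\<close>
  define L where "L v = (fst (snd (snd (D a v))), snd (snd (snd (snd (snd (D a v))))))" for v
  have D_eq: "D a v = (0, 0, fst (L v), 0, 0, snd (L v))" for v
  proof -
    obtain \<rho> \<kappa> where "D a v = (0, 0, \<rho>, 0, 0, \<kappa>)"
      by (rule special_tangent_space[OF csm, of "\<lambda>t. \<Phi> (a + t *\<^sub>R v)" K h "D a v" 0])
        (use in_level line[of a v 0] a in simp_all)
    then show ?thesis
      by (simp add: L_def)
  qed
  have "linear L"
    by (rule linearI) (simp_all add: L_def blinfun.add_right blinfun.scaleR_right)
  have "inj L"
  proof (rule injI)
    fix v v' assume "L v = L v'"
    then have "D a v = D a v'"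
      by (simp only: D_eq)
    then show "v = v'"
      by (rule injD[OF inj_D])
  qed
  then have "surj L"
    by (intro linear_injective_imp_surjective[OF \<open>linear L\<close>]) simp_all
  from surjD[OF this, of "(- m\<^sup>2 * s, m * (m\<^sup>2 + c))"]
  obtain \<eta> where L_\<eta>: "L \<eta> = (- m\<^sup>2 * s, m * (m\<^sup>2 + c))"
    by force
  have "D a w = kovalevskaya_field (\<Phi> a)"
    using vector_derivative_unique_at[OF line[of a w 0] flow[of a 0]] by simp
  then have L_w: "L w = (- s, m)"
    by (simp only: L_def a fields_at_special_point[OF csm(1)] fst_conv snd_conv)
  have D_\<eta>: "D a \<eta> = second_field (\<Phi> a)"
    by (simp only: D_eq L_\<eta> a fields_at_special_point[OF csm(1)] fst_conv snd_conv)
  have span: "\<exists>\<alpha> \<beta>. d = \<alpha> *\<^sub>R w + \<beta> *\<^sub>R \<eta>" for d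
  proof -
    define e f where "e = fst (L d)" and "f = snd (L d)"
    \<comment> \<open>Cramer's rule for the two velocities, with determinant
      \<open>- s * c * m\<close>.\<close>
    define \<alpha> \<beta> where "\<alpha> = - (e * (m\<^sup>2 + c) + f * (m * s)) / (s * c)" and "\<beta> = (e * m + s * f) / (m * s * c)"
    have "- \<alpha> * s - \<beta> * (m\<^sup>2 * s) = e" "\<alpha> * m + \<beta> * (m * (m\<^sup>2 + c)) = f"
      using csm(2-4) by (simp_all add: \<alpha>_def \<beta>_def field_simps power2_eq_square)
    then have "L (\<alpha> *\<^sub>R w + \<beta> *\<^sub>R \<eta>) = L d"
      using linear_add[OF \<open>linear L\<close>] linear_scale[OF \<open>linear L\<close>]
      by (simp add: L_w L_\<eta> e_def f_def prod_eq_iff)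
    then show ?thesis
      using injD[OF \<open>inj L\<close>] by blast
  qed
  have orbit: "D (a + t *\<^sub>R w) \<eta> = second_field (\<Phi> (a + t *\<^sub>R w))" for t
  proof -
    have "D (a + t *\<^sub>R w) \<eta> - second_field (\<Phi> (a + t *\<^sub>R w)) = 0"
    proof (rule zero_if_linear_growth)
      fix t
      let ?z = "\<Phi> (a + t *\<^sub>R w)" and ?e = "D (a + t *\<^sub>R w) \<eta> - second_field (\<Phi> (a + t *\<^sub>R w))"
      have "((\<lambda>t. D (a + t *\<^sub>R w) \<eta> - second_field (\<Phi> (a + t *\<^sub>R w))) has_vector_derivative
          field_derivative ?z (D (a + t *\<^sub>R w) \<eta>) - field_derivative ?z (second_field ?z)) (at t)"
        by (intro has_vector_derivative_diff second_field_along_solution flow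
              variational_equation[OF D cont_D kovalevskaya_field_has_derivative field_derivative_continuous_on flow])
      then show "((\<lambda>t. D (a + t *\<^sub>R w) \<eta> - second_field (\<Phi> (a + t *\<^sub>R w))) has_vector_derivative
          field_derivative ?z ?e) (at t)"
        by (simp only: linear_diff[OF has_derivative_linear[OF kovalevskaya_field_has_derivative]])
      show "norm (field_derivative ?z ?e) \<le> (14 * sqrt (2 * h + 3) + 2) * norm ?e"
        by (rule norm_field_derivative_le[OF norm_zero_area_level_le[OF in_level]])
    qed (simp add: D_\<eta>)
    then show ?thesis
      by simp
  qed
  \<comment> \<open>The orbit is dense only modulo 2 pi. Periodicity of the derivative puts all
    translates of the orbit by periods into the closed set \<open>C\<close> below.\<close>
  have D_period: "D (b + (2 * pi * of_int m, 2 * pi * of_int n)) = D b" for b and m n :: int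
  proof (rule blinfun_eqI)
    fix v
    let ?P = "(2 * pi * of_int m, 2 * pi * of_int n)"
    have "\<Phi> (x + ?P) = \<Phi> x" for x
      by (cases x) (auto simp: period)
    moreover have "b + ?P + t *\<^sub>R v = b + t *\<^sub>R v + ?P" for t
      by (simp only: ac_simps)
    ultimately have "((\<lambda>t. \<Phi> (b + t *\<^sub>R v)) has_vector_derivative D (b + ?P + 0 *\<^sub>R v) v) (at 0)"
      using line[of "b + ?P" v 0] by (simp only:)
    then show "D (b + ?P) v = D b v"
      using vector_derivative_unique_at[OF _ line[of b v 0]] by simp
  qed
  define C where "C = {b. D b \<eta> = second_field (\<Phi> b)}"
  have "closed C"
    unfolding C_def
    by (intro closed_Collect_eq blinfun.continuous_on[OF cont_D continuous_on_const]
          continuous_on_compose2[OF second_field_continuous_on cont_\<Phi>]) auto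
  have everywhere: "D b \<eta> = second_field (\<Phi> b)" for b
  proof -
    have "(fst b, snd b) \<in> C"
    proof (rule winding_line_dense[OF indep \<open>closed C\<close>])
      fix t :: real and m n :: int
      let ?P = "(2 * pi * of_int m, 2 * pi * of_int n)"
      have "\<Phi> (a + t *\<^sub>R w + ?P) = \<Phi> (a + t *\<^sub>R w)"
        by (cases "a + t *\<^sub>R w") (auto simp: period)
      then have "a + t *\<^sub>R w + ?P \<in> C"
        by (simp only: C_def mem_Collect_eq D_period orbit)
      moreover have "a + t *\<^sub>R w + ?P =
          (fst a + \<omega>1 * t + 2 * pi * of_int m, snd a + \<omega>2 * t + 2 * pi * of_int n)"
        by (cases a) (simp add: w_def mult.commute[of _ \<omega>1] mult.commute[of _ \<omega>2])
      ultimately show "(fst a + \<omega>1 * t + 2 * pi * of_int m, snd a + \<omega>2 * t + 2 * pi * of_int n) \<in> C"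
        by simp
    qed
    then show ?thesis
      by (simp add: C_def)
  qed
  show ?thesis
  proof (rule that)
    show "((\<lambda>t. \<Phi> (b + t *\<^sub>R \<eta>)) has_vector_derivative second_field (\<Phi> (b + t *\<^sub>R \<eta>))) (at t)" for b t
      using line[of b \<eta> t] by (simp only: everywhere)
    show "\<exists>\<alpha> \<beta>. d = \<alpha> *\<^sub>R (\<omega>1, \<omega>2) + \<beta> *\<^sub>R \<eta>" for d
      using span by (simp only: w_def)
  qed
qed

section \<open>Boundedness of the precession angle\<close>

theorem proposition2:
  fixes x :: "real \<Rightarrow> phase" and \<psi> :: "real \<Rightarrow> real" and K h :: real
  assumes "kovalevskaya_solution x"
    and "\<And>t. geometric_integral (x t) = 1"
    and "\<And>t. area_integral (x t) = 0"
    and "\<And>t. energy_integral (x t) = h"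
    and "\<And>t. kovalevskaya_integral (x t) = K"
    and "(K, h) \<in> region_O1"
    and "non_resonant_torus (zero_area_level K h)"
    and "precession_angle x \<psi>"
  shows "has_mean_motion \<psi> 0"
proof -
  let ?T = "zero_area_level K h"
  have x_level: "x t \<in> ?T" for t
    using assms(2-5) by (simp add: zero_area_level_def)
  obtain \<Phi> \<omega>1 \<omega>2 where angles: "linearizing_angles ?T \<Phi> \<omega>1 \<omega>2"
    and indep: "rationally_independent \<omega>1 \<omega>2"
    using assms(7) unfolding non_resonant_torus_def by blast
  define w where "w = (\<omega>1, \<omega>2)"
  obtain \<eta> where second_flow:
      "\<And>b t. ((\<lambda>t. \<Phi> (b + t *\<^sub>R \<eta>)) has_vector_derivative second_field (\<Phi> (b + t *\<^sub>R \<eta>))) (at t)"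
    and span: "\<And>d. \<exists>\<alpha> \<beta>. d = \<alpha> *\<^sub>R w + \<beta> *\<^sub>R \<eta>"
    using second_field_direction[OF angles indep assms(6)] unfolding w_def by blast
  have range: "range \<Phi> = ?T"
    using angles unfolding linearizing_angles_def by blast
  then have in_level: "\<Phi> b \<in> ?T" for b
    by blast
  have solution: "kovalevskaya_solution (\<lambda>t. \<Phi> (b + t *\<^sub>R w))" for b
    using angles unfolding linearizing_angles_def
    by (cases b) (simp add: w_def mult.commute[of _ \<omega>1] mult.commute[of _ \<omega>2])
  then have flow: "((\<lambda>t. \<Phi> (b + t *\<^sub>R w)) has_vector_derivative kovalevskaya_field (\<Phi> (b + t *\<^sub>R w))) (at t)"
    for b t
    by (simp add: kovalevskaya_solution_def)
  have cont_\<Phi>: "continuous_on UNIV \<Phi>"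
  proof -
    obtain D :: "real \<times> real \<Rightarrow> (real \<times> real) \<Rightarrow>\<^sub>L phase"
      where D: "\<And>a. (\<Phi> has_derivative blinfun_apply (D a)) (at a)"
      using angles unfolding linearizing_angles_def by blast
    show ?thesis
      by (intro continuous_at_imp_continuous_on ballI has_derivative_continuous[OF D])
  qed
  have nonzero: "horizontal_square (\<Phi> b) \<noteq> 0" for b
    using horizontal_square_nonzero[OF in_level assms(6)] .
  have T_subset: "?T \<subseteq> {z. horizontal_square z \<noteq> 0}"
    using horizontal_square_nonzero[OF _ assms(6)] by blast
  have cont: "continuous_on UNIV (\<lambda>b. f (\<Phi> b))" if "continuous_on {z. horizontal_square z \<noteq> 0} f" for f :: "phase \<Rightarrow> real"
    by (rule continuous_on_compose2[OF that cont_\<Phi>]) (use nonzero in blast)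
  have bound: "\<exists>M. \<forall>b. \<bar>f (\<Phi> b)\<bar> \<le> M" if "continuous_on {z. horizontal_square z \<noteq> 0} f" for f :: "phase \<Rightarrow> real"
  proof -
    have "bounded (f ` ?T)"
      by (intro compact_imp_bounded compact_continuous_image compact_zero_area_level
            continuous_on_subset[OF that T_subset])
    then show ?thesis
      using in_level unfolding bounded_iff by (metis imageI real_norm_def)
  qed
  define F where "F b = precession_rate (\<Phi> b)" for b
  obtain M where M: "\<And>b. \<bar>F b\<bar> \<le> M"
    using bound[OF precession_rate_continuous_on] unfolding F_def by blast
  obtain N where N: "\<And>b. \<bar>second_rate (\<Phi> b)\<bar> \<le> N"
    using bound[OF second_rate_continuous_on] by blast
  have cont_F: "continuous_on UNIV F"
    unfolding F_def by (rule cont[OF precession_rate_continuous_on])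
  define I where "I b t = integral {0..t} (\<lambda>s. F (b + s *\<^sub>R w))" for b t
  \<comment> \<open>For a shift along the flow itself, \<open>F\<close> also takes the role of
    \<open>G\<close>.\<close>
  have shift_w: "\<bar>I (b + \<sigma> *\<^sub>R w) t - I b t\<bar> \<le> 2 * M * \<bar>\<sigma>\<bar>" if "0 \<le> t" for b \<sigma> t
    unfolding I_def
  proof (rule integral_along_shifted_line[OF _ _ cont_F _ M that])
    show "continuous_on UNIV (\<lambda>b. rate_derivative (\<Phi> b) (kovalevskaya_field (\<Phi> b)))"
      by (intro cont rate_derivative_continuous_on kovalevskaya_field_continuous_on order.refl)
  qed (auto simp: F_def intro!: precession_rate_has_derivative flow nonzero)
  \<comment> \<open>For a shift along \<eta> the role of \<open>G\<close> falls to
    \<open>second_rate\<close>; the common derivative is \<open>rate_derivative\<close> in the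
    direction of the second field.\<close>
  have shift_\<eta>: "\<bar>I (b + \<sigma> *\<^sub>R \<eta>) t - I b t\<bar> \<le> 2 * N * \<bar>\<sigma>\<bar>" if "0 \<le> t" for b \<sigma> t
    unfolding I_def
  proof (rule integral_along_shifted_line[OF _ _ cont_F _ N that])
    show "continuous_on UNIV (\<lambda>b. rate_derivative (\<Phi> b) (second_field (\<Phi> b)))"
      by (intro cont rate_derivative_continuous_on second_field_continuous_on order.refl)
  qed (auto simp: F_def intro!: precession_rate_has_derivative second_rate_along_solution flow second_flow nonzero)
  \<comment> \<open>The angles cover the whole level, so uniqueness turns every solution on it into
    a straight line with direction \<open>w\<close>. This applies to the given solution and to its
    mirror image alike.\<close>
  have lift: "\<exists>a. \<forall>t. y t = \<Phi> (a + t *\<^sub>R w)" if y: "kovalevskaya_solution y" "\<And>t. y t \<in> ?T" for y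
  proof -
    obtain a where "\<Phi> a = y 0"
      using y(2)[of 0] range by (metis imageE)
    then have "y t = \<Phi> (a + t *\<^sub>R w)" for t
      using kovalevskaya_solution_unique[OF y(1) solution[of a] norm_zero_area_level_le[OF y(2)]
          norm_zero_area_level_le[OF in_level]] by simp
    then show ?thesis
      by blast
  qed
  obtain a where a: "\<And>t. x t = \<Phi> (a + t *\<^sub>R w)"
    using lift[OF assms(1) x_level] by blast
  obtain b where b: "\<And>t. reflection (x t) = \<Phi> (b + t *\<^sub>R w)"
    using lift[OF reflection_solution[OF assms(1)] reflection_zero_area_level[OF x_level]] by blast
  obtain \<alpha> \<beta> where "b - a = \<alpha> *\<^sub>R w + \<beta> *\<^sub>R \<eta>"
    using span by blast
  \<comment> \<open>The displacement between the two lines is the same at every time, so \<alpha>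
    and \<beta>, and with them the bound, do not depend on \<open>u\<close> or
    \<open>t\<close>.\<close>
  then have b_eq: "b + u *\<^sub>R w = a + u *\<^sub>R w + \<alpha> *\<^sub>R w + \<beta> *\<^sub>R \<eta>" for u
    by (simp add: algebra_simps)
  define B where "B = M * \<bar>\<alpha>\<bar> + N * \<bar>\<beta>\<bar>"
  \<comment> \<open>A start at an arbitrary time \<open>u\<close> also covers negative times: there
    the increment runs from \<open>t\<close> forward to 0. The constant \<open>B\<close> is half of
    the combined shift bound, since the two increments are opposite and their difference is twice
    one of them.\<close>
  have increment: "\<bar>\<psi> (t + u) - \<psi> u\<bar> \<le> B" if "0 \<le> t" for u t
  proof -
    have "a + (s + u) *\<^sub>R w = a + u *\<^sub>R w + s *\<^sub>R w" for s
      by (simp add: scaleR_add_left)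
    moreover have "((\<lambda>s. \<psi> (s + u)) has_real_derivative F (a + (s + u) *\<^sub>R w)) (at s)" for s
      using assms(8) by (simp add: precession_angle_def F_def a flip: DERIV_shift)
    ultimately have deriv: "((\<lambda>s. \<psi> (s + u)) has_real_derivative F (a + u *\<^sub>R w + s *\<^sub>R w)) (at s)" for s
      by (simp only:)
    have "((\<lambda>s. F (a + u *\<^sub>R w + s *\<^sub>R w)) has_integral \<psi> (t + u) - \<psi> (0 + u)) {0..t}"
      by (rule fundamental_theorem_of_calculus[OF that])
        (rule has_vector_derivative_at_within[OF deriv[unfolded has_real_derivative_iff_has_vector_derivative]])
    then have I_a: "I (a + u *\<^sub>R w) t = \<psi> (t + u) - \<psi> u"
      unfolding I_def by (simp add: integral_unique)
    have "F (b + u *\<^sub>R w + s *\<^sub>R w) = - F (a + u *\<^sub>R w + s *\<^sub>R w)" for s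
      using precession_rate_reflection[of "x (s + u)"] unfolding b unfolding a
      by (simp add: F_def scaleR_add_left ac_simps)
    then have "I (b + u *\<^sub>R w) t = - I (a + u *\<^sub>R w) t"
      by (simp add: I_def)
    moreover have "\<bar>I (b + u *\<^sub>R w) t - I (a + u *\<^sub>R w) t\<bar> \<le> 2 * B"
      using shift_\<eta>[OF that, of "a + u *\<^sub>R w + \<alpha> *\<^sub>R w" \<beta>] shift_w[OF that, of "a + u *\<^sub>R w" \<alpha>]
      unfolding b_eq B_def by (simp add: algebra_simps)
    ultimately show ?thesis
      unfolding I_a by linarith
  qed
  have "norm (\<psi> t - 0 * t) \<le> \<bar>\<psi> 0\<bar> + B" for t
  proof (cases "0 \<le> t")
    case True
    then show ?thesis
      using increment[of t 0] by simp
  next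
    case False
    then show ?thesis
      using increment[of "- t" t] by simp
  qed
  then show ?thesis
    unfolding has_mean_motion_def by (auto intro!: boundedI)
qed

end
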